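(* Let $t$ be a decision tree over $d$ features with $p$ leaves having scores $s_1,\dots,s_p\in\mathbb{R}$, and for each feature $i\in[d]$ let $\theta_{i1}<\dots<\theta_{iK_i}$ be the distinct split thresholds on feature $i$; put $K=\sum_{i=1}^d K_i$. Let $Q^{misic}$ be the set of $(\bm{x},y,\bm{z})\in\mathbb{R}^{K}\times\mathbb{R}\times\mathbb{R}^{p}$, $\bm{x}=(x_{ij})_{i\in[d],j\in[K_i]}$, satisfying $$\sum_{l\in \mathrm{left}(s)} z_l\le x_{V(s)C(s)},\qquad \sum_{l\in \mathrm{right}(s)} z_l\le 1-x_{V(s)C(s)}\qquad\forall s\in \mathrm{splits}(t),$$ $$x_{ij}\le x_{i,j+1}\ \ \forall i\in[d],\,j\in[K_i-1],\qquad \sum_{l=1}^p z_l=1,\qquad y=\sum_{l=1}^p s_lz_l,\qquad \bm{x}\in[0,1]^K,\quad \bm{z}\ge0.$$ Let $Q^{elbow}$ be the set of $(\bm{x},y,\bm{z})\in Q^{misic}$ that satisfy in addition $$\sum_{l\in \mathrm{right}(s)}z_l\le x_{V(s')C(s')}-x_{V(s)C(s)}\qquad\forall s\in \mathrm{splits}(t),\ s'\in \mathrm{right\_parent}(s),$$ $$\sum_{l\in \mathrm{left}(s)}z_l\le x_{V(s)C(s)}-x_{V(s')C(s')}\qquad\forall s\in \mathrm{splits}(t),\ s'\in \mathrm{left\_parent}(s).$$ Then $$Q^{elbow}\cap\big(\{0,1\}^K\times\mathbb{R}^{1+p}\big)=Q^{misic}\cap\big(\{0,1\}^K\times\mathbb{R}^{1+p}\big)\qquad\text{and}\qquad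 Q^{elbow}\subseteq Q^{misic}.$$
   Context: Notation: $[n]=\{1,\dots,n\}$. A decision tree is a binary tree. Each internal node is a split $s$, given by a condition $w_i\le\theta$ on one feature $i$; the left branch corresponds to $w_i\le\theta$ and the right branch to $w_i\ge\theta$. $\mathrm{splits}(t)$ is the set of splits of tree $t$. $\mathrm{left}(s)$ and $\mathrm{right}(s)$ are the sets of leaves lying in the left, respectively right, subtree of $s$. For a split $s$ with condition $w_i\le\theta_{ij}$, $V(s)=i$ is its feature and $C(s)=j$ is the rank of its threshold. $\mathrm{right\_parent}(s)$ is the set of splits $s'$ on the same feature as $s$ such that $s$ lies in the left subtree of $s'$ (so $s'$ is above and to the right of $s$); the threshold of such $s'$ is larger than that of $s$. $\mathrm{left\_parent}(s)$ is the set of splits $s'$ on the same feature as $s$ such that $s$ lies in the right subtree of $s'$; the threshold of such $s'$ is smaller than that of $s$. (These threshold relations are part of what is meant by a decision tree here.) Interpretation: $x_{ij}=1$ means $w_i\le\theta_{ij}$, $x_{ij}=0$ means $w_i\ge\theta_{ij}$; $z_l$ indicates that the feature vector lies in leaf $l$. The mixed-integer formulations require only $\bm{x}$ to be binary. *)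

theory Defs
  imports "HOL-Library.FuncSet" Complex_Main
begin

text \<open>
  \<open>Split i \<tau> a b\<close> tests \<open>w\<^sub>i \<le> \<tau>\<close>, with left subtree \<open>a\<close> and right subtree \<open>b\<close>; a leaf carries its
  number in \<open>{1..p}\<close>.
\<close>

datatype dtree =
    Leaf nat
  | Split (feature: nat) (threshold: real) (left_subtree: dtree) (right_subtree: dtree)

primrec leaf_list :: "dtree \<Rightarrow> nat list" where
  "leaf_list (Leaf l) = [l]"
| "leaf_list (Split i \<tau> a b) = leaf_list a @ leaf_list b"

text \<open>
  A split is identified with the subtree rooted at it. In a tree with distinct leaf numbers,
  different internal nodes have different subtrees, so two nodes with the same condition are
  still different splits.
\<close>

primrec splits :: "dtree \<Rightarrow> dtree set" where
  "splits (Leaf l) = {}"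
| "splits (Split i \<tau> a b) = insert (Split i \<tau> a b) (splits a \<union> splits b)"

definition left_leaves :: "dtree \<Rightarrow> nat set" where
  "left_leaves s = set (leaf_list (left_subtree s))"

definition right_leaves :: "dtree \<Rightarrow> nat set" where
  "right_leaves s = set (leaf_list (right_subtree s))"

definition right_parent :: "dtree \<Rightarrow> dtree \<Rightarrow> dtree set" where
  "right_parent t s = {s' \<in> splits t. feature s' = feature s \<and> s \<in> splits (left_subtree s')}"

definition left_parent :: "dtree \<Rightarrow> dtree \<Rightarrow> dtree set" where
  "left_parent t s = {s' \<in> splits t. feature s' = feature s \<and> s \<in> splits (right_subtree s')}"

definition decision_tree :: "nat \<Rightarrow> nat \<Rightarrow> dtree \<Rightarrow> bool" where
  "decision_tree d p t \<longleftrightarrow>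
     feature ` splits t \<subseteq> {1..d} \<and>
     distinct (leaf_list t) \<and> set (leaf_list t) = {1..p} \<and>
     (\<forall>s\<in>splits t. \<forall>s'\<in>right_parent t s. threshold s < threshold s') \<and>
     (\<forall>s\<in>splits t. \<forall>s'\<in>left_parent t s. threshold s' < threshold s)"

definition thresholds :: "dtree \<Rightarrow> nat \<Rightarrow> real set" where
  "thresholds t i = threshold ` {s \<in> splits t. feature s = i}"

text \<open>\<open>\<theta> i 1 < \<dots> < \<theta> i (K i)\<close> are the distinct split thresholds of \<open>t\<close> on feature \<open>i\<close>.\<close>

definition threshold_enum :: "nat \<Rightarrow> dtree \<Rightarrow> (nat \<Rightarrow> nat) \<Rightarrow> (nat \<Rightarrow> nat \<Rightarrow> real) \<Rightarrow> bool" where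
  "threshold_enum d t K \<theta> \<longleftrightarrow>
     (\<forall>i\<in>{1..d}. strict_mono_on {1..K i} (\<theta> i) \<and> \<theta> i ` {1..K i} = thresholds t i)"

definition split_rank :: "(nat \<Rightarrow> nat) \<Rightarrow> (nat \<Rightarrow> nat \<Rightarrow> real) \<Rightarrow> dtree \<Rightarrow> nat" where
  "split_rank K \<theta> s = (THE j. j \<in> {1..K (feature s)} \<and> \<theta> (feature s) j = threshold s)"

text \<open>The vectors \<open>x\<close> and \<open>z\<close> are extensional functions on the index sets below.\<close>

definition x_index :: "nat \<Rightarrow> (nat \<Rightarrow> nat) \<Rightarrow> (nat \<times> nat) set" where
  "x_index d K = (SIGMA i:{1..d}. {1..K i})"

definition x_at :: "(nat \<Rightarrow> nat) \<Rightarrow> (nat \<Rightarrow> nat \<Rightarrow> real) \<Rightarrow> (nat \<times> nat \<Rightarrow> real) \<Rightarrow> dtree \<Rightarrow> real" where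
  "x_at K \<theta> x s = x (feature s, split_rank K \<theta> s)"

type_synonym point = "(nat \<times> nat \<Rightarrow> real) \<times> real \<times> (nat \<Rightarrow> real)"

definition Q_misic ::
  "nat \<Rightarrow> nat \<Rightarrow> dtree \<Rightarrow> (nat \<Rightarrow> real) \<Rightarrow> (nat \<Rightarrow> nat) \<Rightarrow> (nat \<Rightarrow> nat \<Rightarrow> real) \<Rightarrow> point set" where
  "Q_misic d p t score K \<theta> = {(x, y, z).
     x \<in> x_index d K \<rightarrow>\<^sub>E {0..1} \<and>
     z \<in> {1..p} \<rightarrow>\<^sub>E {0..} \<and>
     (\<forall>s\<in>splits t. (\<Sum>l\<in>left_leaves s. z l) \<le> x_at K \<theta> x s) \<and>
     (\<forall>s\<in>splits t. (\<Sum>l\<in>right_leaves s. z l) \<le> 1 - x_at K \<theta> x s) \<and>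
     (\<forall>i\<in>{1..d}. \<forall>j\<in>{1..<K i}. x (i, j) \<le> x (i, j + 1)) \<and>
     (\<Sum>l=1..p. z l) = 1 \<and>
     y = (\<Sum>l=1..p. score l * z l)}"

definition Q_elbow ::
  "nat \<Rightarrow> nat \<Rightarrow> dtree \<Rightarrow> (nat \<Rightarrow> real) \<Rightarrow> (nat \<Rightarrow> nat) \<Rightarrow> (nat \<Rightarrow> nat \<Rightarrow> real) \<Rightarrow> point set" where
  "Q_elbow d p t score K \<theta> = {(x, y, z). (x, y, z) \<in> Q_misic d p t score K \<theta> \<and>
     (\<forall>s\<in>splits t. \<forall>s'\<in>right_parent t s.
        (\<Sum>l\<in>right_leaves s. z l) \<le> x_at K \<theta> x s' - x_at K \<theta> x s) \<and>
     (\<forall>s\<in>splits t. \<forall>s'\<in>left_parent t s.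
        (\<Sum>l\<in>left_leaves s. z l) \<le> x_at K \<theta> x s - x_at K \<theta> x s')}"

definition binary_points :: "nat \<Rightarrow> nat \<Rightarrow> (nat \<Rightarrow> nat) \<Rightarrow> point set" where
  "binary_points d p K = (x_index d K \<rightarrow>\<^sub>E {0, 1}) \<times> UNIV \<times> ({1..p} \<rightarrow>\<^sub>E UNIV)"

end

theory Submission
  imports Defs
begin

text \<open>
  The elbow inequalities are valid at a point of the misic set with binary \<open>x\<close> because the
  variable \<open>x'\<close> of the ancestor split \<open>s'\<close> decides between two trivial situations. Let \<open>s\<close> lie in
  the left subtree of \<open>s'\<close>, on the same feature, and let \<open>x\<^sub>s\<close> be its variable; the threshold of \<open>s\<close>
  is smaller, so the chain of order constraints gives \<open>x\<^sub>s \<le> x'\<close>. If \<open>x' = 1\<close>, the elbow inequality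
  is literally the misic inequality of \<open>s\<close>. If \<open>x' = 0\<close>, no weight reaches the left subtree of \<open>s'\<close>,
  which contains all leaves below \<open>s\<close>, and \<open>x\<^sub>s \<le> 0\<close>, so the inequality follows from \<open>0 \<le> - x\<^sub>s\<close>.
  The case of the right subtree is the mirror image under \<open>x \<mapsto> 1 - x\<close>, which also exchanges left
  and right leaves.

  The tree enters only through two facts: the leaves below \<open>s\<close> are among the leaves on the relevant
  side of \<open>s'\<close>, and \<open>x_at\<close> is monotone in the threshold among the splits on one feature
  (\<open>x_at_mono\<close>).
\<close>

lemma leaves_of_split_subset:
  assumes "s \<in> splits u"
  shows "left_leaves s \<subseteq> set (leaf_list u)" and "right_leaves s \<subseteq> set (leaf_list u)"
  using assms by (induction u) (auto simp: left_leaves_def right_leaves_def)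

text \<open>Turns the description in \<open>split_rank\<close> into usable facts: strict monotonicity of the
  enumeration makes the rank unique.\<close>

lemma split_rank_props:
  assumes enum: "threshold_enum d t K \<theta>" and s: "s \<in> splits t" and i: "feature s \<in> {1..d}"
  shows "split_rank K \<theta> s \<in> {1..K (feature s)}"
    and "\<theta> (feature s) (split_rank K \<theta> s) = threshold s"
proof -
  have sm: "strict_mono_on {1..K (feature s)} (\<theta> (feature s))"
    and im: "\<theta> (feature s) ` {1..K (feature s)} = thresholds t (feature s)"
    using enum i unfolding threshold_enum_def by blast+
  have "threshold s \<in> thresholds t (feature s)"
    using s unfolding thresholds_def by blast
  then obtain j where "j \<in> {1..K (feature s)}" "\<theta> (feature s) j = threshold s"
    unfolding im[symmetric] by force
  then have "\<exists>!j. j \<in> {1..K (feature s)} \<and> \<theta> (feature s) j = threshold s"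
    using strict_mono_on_imp_inj_on[OF sm] by (metis inj_onD)
  from theI'[OF this] show "split_rank K \<theta> s \<in> {1..K (feature s)}"
    and "\<theta> (feature s) (split_rank K \<theta> s) = threshold s"
    unfolding split_rank_def by blast+
qed

lemma x_at_mono:
  fixes x :: "nat \<times> nat \<Rightarrow> real"
  assumes enum: "threshold_enum d t K \<theta>"
    and steps: "\<And>i j. i \<in> {1..d} \<Longrightarrow> j \<in> {1..<K i} \<Longrightarrow> x (i, j) \<le> x (i, j + 1)"
    and s: "s \<in> splits t" and s': "s' \<in> splits t"
    and i: "feature s \<in> {1..d}" and same: "feature s' = feature s"
    and less: "threshold s < threshold s'"
  shows "x_at K \<theta> x s \<le> x_at K \<theta> x s'"
proof -
  let ?i = "feature s" and ?j = "split_rank K \<theta> s" and ?k = "split_rank K \<theta> s'"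
  have j: "?j \<in> {1..K ?i}" "\<theta> ?i ?j = threshold s"
    using split_rank_props[OF enum s i] by auto
  have k: "?k \<in> {1..K ?i}" "\<theta> ?i ?k = threshold s'"
    using split_rank_props[OF enum s'] i same by auto
  have "strict_mono_on {1..K ?i} (\<theta> ?i)"
    using enum i unfolding threshold_enum_def by blast
  then have "?j \<le> ?k"
    using j k less by (metis strict_mono_on_less_eq less_eq_real_def)
  then have "?k \<le> K ?i \<longrightarrow> x (?i, ?j) \<le> x (?i, ?k)"
  proof (induction rule: dec_induct)
    case (step n)
    show ?case
    proof
      assume "Suc n \<le> K ?i"
      then have "x (?i, n) \<le> x (?i, n + 1)" and "x (?i, ?j) \<le> x (?i, n)"
        using steps[OF i, of n] step j(1) by auto
      then show "x (?i, ?j) \<le> x (?i, Suc n)" by simp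
    qed
  qed simp
  then show ?thesis
    using k(1) by (simp add: x_at_def same)
qed

theorem proposition5:
  fixes d p :: nat and t :: dtree and score :: "nat \<Rightarrow> real"
    and K :: "nat \<Rightarrow> nat" and \<theta> :: "nat \<Rightarrow> nat \<Rightarrow> real"
  assumes "decision_tree d p t"
    and "threshold_enum d t K \<theta>"
  shows "Q_elbow d p t score K \<theta> \<inter> binary_points d p K
           = Q_misic d p t score K \<theta> \<inter> binary_points d p K
         \<and> Q_elbow d p t score K \<theta> \<subseteq> Q_misic d p t score K \<theta>"
proof -
  have relaxation: "Q_elbow d p t score K \<theta> \<subseteq> Q_misic d p t score K \<theta>"
    unfolding Q_elbow_def by auto
  have "(x, y, z) \<in> Q_elbow d p t score K \<theta>"
    if Q: "(x, y, z) \<in> Q_misic d p t score K \<theta>" and B: "(x, y, z) \<in> binary_points d p K"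
    for x y z
  proof -
    have feat: "feature s \<in> {1..d}" if "s \<in> splits t" for s
      using assms(1) that unfolding decision_tree_def by blast
    have leaves: "set (leaf_list t) = {1..p}"
      using assms(1) unfolding decision_tree_def by blast
    have z_nonneg: "0 \<le> z l" if "l \<in> {1..p}" for l
      using Q that unfolding Q_misic_def by auto
    have left: "(\<Sum>l\<in>left_leaves s. z l) \<le> x_at K \<theta> x s"
      and right: "(\<Sum>l\<in>right_leaves s. z l) \<le> 1 - x_at K \<theta> x s" if "s \<in> splits t" for s
      using Q that unfolding Q_misic_def by auto
    have steps: "x (i, j) \<le> x (i, j + 1)" if "i \<in> {1..d}" "j \<in> {1..<K i}" for i j
      using Q that unfolding Q_misic_def by auto
    have binary: "x_at K \<theta> x s = 0 \<or> x_at K \<theta> x s = 1" if "s \<in> splits t" for s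
    proof -
      have "(feature s, split_rank K \<theta> s) \<in> x_index d K"
        using split_rank_props(1)[OF assms(2) that feat[OF that]] feat[OF that]
        unfolding x_index_def by blast
      then show ?thesis
        using B unfolding binary_points_def x_at_def by auto
    qed
    have weight_mono: "sum z A \<le> sum z A'" if "A \<subseteq> A'" "A' \<subseteq> {1..p}" for A A'
      using that z_nonneg by (intro sum_mono2) (auto intro: finite_subset)

    have elbow_right:
      "(\<Sum>l\<in>right_leaves s. z l) \<le> x_at K \<theta> x s' - x_at K \<theta> x s"
      if s: "s \<in> splits t" and parent: "s' \<in> right_parent t s" for s s'
    proof -
      have s': "s' \<in> splits t" and same: "feature s' = feature s"
        and below: "s \<in> splits (left_subtree s')"
        using parent unfolding right_parent_def by auto
      have "threshold s < threshold s'"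
        using assms(1) s parent unfolding decision_tree_def by blast
      then have mono: "x_at K \<theta> x s \<le> x_at K \<theta> x s'"
        using x_at_mono[OF assms(2) steps s s' feat[OF s] same] by blast
      have "right_leaves s \<subseteq> left_leaves s'"
        using leaves_of_split_subset(2)[OF below] unfolding left_leaves_def .
      then have "(\<Sum>l\<in>right_leaves s. z l) \<le> (\<Sum>l\<in>left_leaves s'. z l)"
        using leaves_of_split_subset(1)[OF s'] leaves by (intro weight_mono) auto
      then show ?thesis
        using binary[OF s'] left[OF s'] right[OF s] mono by linarith
    qed

    have elbow_left:
      "(\<Sum>l\<in>left_leaves s. z l) \<le> x_at K \<theta> x s - x_at K \<theta> x s'"
      if s: "s \<in> splits t" and parent: "s' \<in> left_parent t s" for s s'
    proof -
      have s': "s' \<in> splits t" and same: "feature s' = feature s"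
        and below: "s \<in> splits (right_subtree s')"
        using parent unfolding left_parent_def by auto
      have "threshold s' < threshold s"
        using assms(1) s parent unfolding decision_tree_def by blast
      then have mono: "x_at K \<theta> x s' \<le> x_at K \<theta> x s"
        using x_at_mono[OF assms(2) steps s' s feat[OF s'] same[symmetric]] by blast
      have "left_leaves s \<subseteq> right_leaves s'"
        using leaves_of_split_subset(1)[OF below] unfolding right_leaves_def .
      then have "(\<Sum>l\<in>left_leaves s. z l) \<le> (\<Sum>l\<in>right_leaves s'. z l)"
        using leaves_of_split_subset(2)[OF s'] leaves by (intro weight_mono) auto
      then show ?thesis
        using binary[OF s'] right[OF s'] left[OF s] mono by linarith
    qed

    show ?thesis
      using Q elbow_right elbow_left unfolding Q_elbow_def by blast
  qed
  with relaxation show ?thesis by auto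
qed

end
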